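(* Let $p$ be a prime. If $n \ge 3$ is an integer, then there exists an ultraspecial group of order $p^{3n}$ having only one abelian subgroup of order $p^{2n}$ (that is, having exactly one such subgroup).
   Context: A finite $p$-group $G$ is semi-extraspecial if for every subgroup $N$ of index $p$ in $Z(G)$ the quotient $G/N$ is an extraspecial group. A semi-extraspecial group $G$ is ultraspecial if $|G'| = |G:G'|^{1/2}$. *)

theory Defs
  imports Complex_Main "HOL-Algebra.Algebra"
begin

definition finite_p_group :: "nat \<Rightarrow> ('a, 'b) monoid_scheme \<Rightarrow> bool" where
  "finite_p_group p G \<longleftrightarrow>
     Factorial_Ring.prime p \<and> group G \<and> finite (carrier G) \<and> (\<exists>k::nat. order G = p ^ k)"

definition group_center :: "('a, 'b) monoid_scheme \<Rightarrow> 'a set" where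
  "group_center G = {z \<in> carrier G. \<forall>g \<in> carrier G. z \<otimes>\<^bsub>G\<^esub> g = g \<otimes>\<^bsub>G\<^esub> z}"

definition elementary_abelian :: "nat \<Rightarrow> ('a, 'b) monoid_scheme \<Rightarrow> bool" where
  "elementary_abelian p G \<longleftrightarrow>
     comm_group G \<and> (\<forall>x \<in> carrier G. x [^]\<^bsub>G\<^esub> p = \<one>\<^bsub>G\<^esub>)"

(* Extraspecial: centre of order p with nontrivial elementary abelian central quotient
   (for p-groups this amounts to G' = Z(G) = Phi(G) of order p). *)
definition extraspecial :: "nat \<Rightarrow> ('a, 'b) monoid_scheme \<Rightarrow> bool" where
  "extraspecial p G \<longleftrightarrow>
     finite_p_group p G \<and> card (group_center G) = p \<and>
     elementary_abelian p (G Mod group_center G) \<and> order (G Mod group_center G) \<noteq> 1"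

definition subgroup_index :: "('a, 'b) monoid_scheme \<Rightarrow> 'a set \<Rightarrow> nat" where
  "subgroup_index G H = card (rcosets\<^bsub>G\<^esub> H)"

definition semi_extraspecial :: "nat \<Rightarrow> ('a, 'b) monoid_scheme \<Rightarrow> bool" where
  "semi_extraspecial p G \<longleftrightarrow>
     finite_p_group p G \<and>
     (\<forall>N. subgroup N (G\<lparr>carrier := group_center G\<rparr>) \<and>
          subgroup_index (G\<lparr>carrier := group_center G\<rparr>) N = p
        \<longrightarrow> extraspecial p (G Mod N))"

definition ultraspecial :: "nat \<Rightarrow> ('a, 'b) monoid_scheme \<Rightarrow> bool" where
  "ultraspecial p G \<longleftrightarrow>
     semi_extraspecial p G \<and>
     real (card (derived G (carrier G))) = sqrt (real (subgroup_index G (derived G (carrier G))))"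

end

theory Submission
  imports Defs "HOL-Number_Theory.Residues"
begin

text \<open>
  Let \<open>F\<close> be the field with \<open>q = p ^ n\<close> elements and let \<open>G\<close> be the set of triples over \<open>F\<close> with
  \<open>(a, b, c) (a', b', c') = (a + a', b + b', c + c' + a b' + g a a')\<close>, where \<open>g\<close> is biadditive.
  The commutator of two elements is \<open>(0, 0, a b' - a' b + g a a' - g a' a)\<close>, so the centre is
  \<open>{(0, 0, c)}\<close> and every noncentral element has all central elements among its commutators; hence \<open>G\<close> is
  ultraspecial. The elements with \<open>a = 0\<close> form an abelian subgroup of order \<open>q ^ 2\<close>. Any other such
  subgroup meets it in the centre only, so it is a graph \<open>b = T a\<close> over the first coordinate,
  and \<open>a (T a') - a' (T a) + g a a' - g a' a\<close> vanishes identically.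
  For \<open>g a a' = a ^ p * a' ^ (p ^ 2)\<close>, setting \<open>a' = 1\<close> determines \<open>T\<close>, and the remaining identity says
  that the Moore determinant of \<open>1, a, a'\<close> is zero. As a polynomial in \<open>a\<close> it has degree \<open>p ^ 2 < q\<close>
  as soon as \<open>a' ^ p \<noteq> a'\<close>, a contradiction.
\<close>

section \<open>Finite fields\<close>

context cring
begin

text \<open>Induction by Pascal's rule. Binomial coefficients are natural numbers, so they enter as
  iterated sums \<open>add_pow\<close> and not as elements of \<open>R\<close>.\<close>

lemma binomial_finsum:
  fixes n :: nat
  assumes "x \<in> carrier R" "y \<in> carrier R"
  shows "(x \<oplus> y) [^] n = (\<Oplus>k \<in> {..n}. add_pow R (n choose k) (x [^] k \<otimes> y [^] (n - k)))"
proof (induction n)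
  case 0
  then show ?case by simp
next
  case (Suc n)
  define t where "t n k = add_pow R (n choose k) (x [^] k \<otimes> y [^] (n - k))" for n k :: nat
  have t[simp]: "t n k \<in> carrier R" for n k
    using assms by (simp add: t_def)
  have raise_x: "t n k \<otimes> x = add_pow R (n choose k) (x [^] Suc k \<otimes> y [^] (n - k))" for k
  proof -
    have "t n k \<otimes> x = add_pow R (n choose k) (x [^] k \<otimes> y [^] (n - k) \<otimes> x)"
      using assms by (simp add: t_def add_pow_ldistr)
    also have "x [^] k \<otimes> y [^] (n - k) \<otimes> x = x [^] Suc k \<otimes> y [^] (n - k)"
      using assms by (simp add: m_ac)
    finally show ?thesis .
  qed
  have raise_y: "t n k \<otimes> y = add_pow R (n choose k) (x [^] k \<otimes> y [^] Suc (n - k))" for k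
    using assms by (simp add: t_def add_pow_ldistr m_assoc)
  \<comment> \<open>Pascal's rule. At \<open>k = n\<close> the term with
    \<open>n choose Suc n\<close> vanishes; for \<open>k < n\<close> the truncated exponent
    \<open>n - Suc k\<close> regains one from the factor \<open>y\<close>.\<close>
  have step: "t (Suc n) (Suc k) = t n k \<otimes> x \<oplus> t n (Suc k) \<otimes> y" if "k \<le> n" for k
  proof (cases "k = n")
    case True
    then show ?thesis
      using assms unfolding raise_x raise_y by (simp add: t_def binomial_eq_0)
  next
    case False
    then have "Suc (n - Suc k) = n - k" using that by simp
    then show ?thesis
      using assms unfolding raise_x raise_y by (simp add: t_def add.nat_pow_mult del: nat_pow_Suc)
  qed
  have bottom: "t (Suc n) 0 = t n 0 \<otimes> y"
    using assms unfolding raise_y by (simp add: t_def)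
  \<comment> \<open>This zero term lets the range \<open>{..n}\<close> grow to
    \<open>{..Suc n}\<close>, so that the shifted sum together with \<open>t n 0\<close> is again
    the full sum.\<close>
  have top: "t n (Suc n) = \<zero>"
    using assms by (simp add: t_def binomial_eq_0)
  have "(\<Oplus>k \<in> {..Suc n}. t (Suc n) k) = (\<Oplus>k \<in> {..n}. t (Suc n) (Suc k)) \<oplus> t (Suc n) 0"
    by (rule finsum_Suc2) simp
  also have "\<dots> = (\<Oplus>k \<in> {..n}. t n k \<otimes> x \<oplus> t n (Suc k) \<otimes> y) \<oplus> t n 0 \<otimes> y"
    using assms by (intro arg_cong2[where f = "(\<oplus>)"] finsum_cong' bottom) (auto simp: step)
  also have "\<dots> = (\<Oplus>k \<in> {..n}. t n k) \<otimes> x \<oplus> ((\<Oplus>k \<in> {..n}. t n (Suc k)) \<oplus> t n 0) \<otimes> y"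
    using assms by (simp add: finsum_addf finsum_ldistr a_assoc l_distr Pi_def)
  also have "(\<Oplus>k \<in> {..n}. t n (Suc k)) \<oplus> t n 0 = (\<Oplus>k \<in> {..Suc n}. t n k)"
    by (rule finsum_Suc2[symmetric]) simp
  also have "\<dots> = (\<Oplus>k \<in> {..n}. t n k)"
    by (simp add: top Pi_def)
  also have "(\<Oplus>k \<in> {..n}. t n k) \<otimes> x \<oplus> (\<Oplus>k \<in> {..n}. t n k) \<otimes> y = (x \<oplus> y) [^] Suc n"
    using assms Suc by (simp add: t_def[symmetric] r_distr[symmetric] finsum_closed Pi_def)
  finally show ?case by (simp add: t_def)
qed

lemma add_pow_char_dvd:
  fixes p m :: nat
  assumes "add_pow R p \<one> = \<zero>" "p dvd m" "x \<in> carrier R"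
  shows "add_pow R m x = \<zero>"
proof -
  obtain k where m: "m = p * k" using assms(2) by blast
  have "add_pow R p \<one> \<otimes> x = add_pow R p x" using assms by (subst add_pow_ldistr) auto
  then have "add_pow R p x = \<zero>" using assms by simp
  then show ?thesis using assms by (simp add: m add.nat_pow_pow[symmetric])
qed

text \<open>A prime divides all inner binomial coefficients, so only the two extreme terms survive.
  The setting is a commutative ring because the map is later applied to polynomials as well as to
  field elements.\<close>

lemma frobenius_add:
  fixes p :: nat
  assumes "Factorial_Ring.prime p" "add_pow R p \<one> = \<zero>" "x \<in> carrier R" "y \<in> carrier R"
  shows "(x \<oplus> y) [^] p = x [^] p \<oplus> y [^] p"
proof -
  define t where "t k = add_pow R (p choose k) (x [^] k \<otimes> y [^] (p - k))" for k :: nat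
  have t[simp]: "t k \<in> carrier R" for k
    using assms by (simp add: t_def)
  \<comment> \<open>Writing \<open>p\<close> as a double successor allows both extreme terms to be
    split off; the inner indices are \<open>Suc k\<close> with \<open>k \<le> r\<close>.\<close>
  obtain r where p: "p = Suc (Suc r)"
    using prime_ge_2_nat[OF assms(1)] by (metis add_2_eq_Suc le_Suc_ex)
  have zero: "t k = \<zero>" if "k \<noteq> 0" "k < p" for k
    unfolding t_def using assms that
    by (intro add_pow_char_dvd[OF assms(2)] dvd_choose_prime) auto
  have "(x \<oplus> y) [^] p = (\<Oplus>k \<in> {..p}. t k)"
    using assms by (simp add: binomial_finsum t_def)
  also have "\<dots> = t p \<oplus> (\<Oplus>k \<in> {..Suc r}. t k)"
    by (simp only: p finsum_Suc[OF Pi_I[OF t]])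
  also have "(\<Oplus>k \<in> {..Suc r}. t k) = (\<Oplus>k \<in> {..r}. t (Suc k)) \<oplus> t 0"
    by (rule finsum_Suc2) simp
  also have "(\<Oplus>k \<in> {..r}. t (Suc k)) = \<zero>"
    using zero p by (intro add.finprod_one_eqI) auto
  finally show ?thesis using assms by (simp add: t_def)
qed

lemma frobenius_pow_add:
  fixes p n :: nat
  assumes "Factorial_Ring.prime p" "add_pow R p \<one> = \<zero>" "x \<in> carrier R" "y \<in> carrier R"
  shows "(x \<oplus> y) [^] (p ^ n) = x [^] (p ^ n) \<oplus> y [^] (p ^ n)"
proof (induction n)
  case (Suc n)
  have e: "z [^] (p ^ Suc n) = (z [^] (p ^ n)) [^] p" if "z \<in> carrier R" for z
    using that by (simp add: nat_pow_pow mult.commute)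
  have "(x \<oplus> y) [^] (p ^ Suc n) = (x [^] (p ^ n) \<oplus> y [^] (p ^ n)) [^] p"
    using assms by (simp only: e add.m_closed Suc)
  also have "\<dots> = x [^] (p ^ Suc n) \<oplus> y [^] (p ^ Suc n)"
    using assms by (simp only: e frobenius_add nat_pow_closed)
  finally show ?case .
qed (use assms in simp)

end

section \<open>Counting roots and constructing finite fields\<close>

lemma (in ring_hom_ring) hom_add_pow:
  fixes n :: nat
  assumes "x \<in> carrier R"
  shows "h (add_pow R n x) = add_pow S n (h x)"
  using assms by (induction n) simp_all

text \<open>As \<open>a\<close> is nonzero the trinomial has degree \<open>m\<close>, which bounds
  the number of roots. The bound serves to refute identities on a field with more than
  \<open>m\<close> elements.\<close>

lemma (in field) card_trinomial_roots_le:
  fixes k m :: nat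
  assumes "a \<in> carrier R" "b \<in> carrier R" "c \<in> carrier R" "a \<noteq> \<zero>" "1 < k" "k < m"
  defines "Z \<equiv> {x \<in> carrier R. a \<otimes> x [^] m \<oplus> b \<otimes> x [^] k \<oplus> c \<otimes> x = \<zero>}"
  shows "finite Z \<and> card Z \<le> m"
proof -
  \<comment> \<open>Coefficients from the top: \<open>a\<close> at degree \<open>m\<close>,
    \<open>b\<close> at degree \<open>k\<close>, \<open>c\<close> at degree 1, and constant term
    zero.\<close>
  define P where "P = a # replicate (m - k - 1) \<zero> @ b # replicate (k - 2) \<zero> @ [c, \<zero>]"
  have P: "P \<in> carrier (poly_ring R)"
    using assms by (auto simp: P_def univ_poly_carrier[symmetric] polynomial_def)
  have "eval P x = a \<otimes> x [^] m \<oplus> b \<otimes> x [^] k \<oplus> c \<otimes> x" if "x \<in> carrier R" for x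
  proof -
    define j where "j = k - 2"
    then have j: "k = Suc (Suc j)" using \<open>1 < k\<close> by simp
    define T where "T = b # replicate j \<zero> @ [c, \<zero>]"
    have T: "eval T x = b \<otimes> x [^] k \<oplus> c \<otimes> x"
      using assms that by (simp add: T_def eval_replicate j)
    have "P = a # replicate (m - k - 1) \<zero> @ T"
      by (simp add: P_def T_def j)
    moreover have "length (replicate (m - k - 1) \<zero> @ T) = m"
      using assms by (simp add: T_def j)
    moreover have "eval (replicate (m - k - 1) \<zero> @ T) x = eval T x"
      using assms that by (intro eval_replicate) (auto simp: T_def)
    ultimately have "eval P x = a \<otimes> x [^] m \<oplus> (b \<otimes> x [^] k \<oplus> c \<otimes> x)"
      by (simp add: T)
    then show ?thesis using assms that by (simp add: a_assoc)
  qed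
  then have "Z = {x. is_root P x}"
    by (auto simp: Z_def is_root_def P_def)
  then have Z: "Z = set_mset (roots P)"
    using roots_mem_iff_is_root[OF P] by auto
  \<comment> \<open>\<open>roots\<close> counts with multiplicity, so its size bounds the number of
    distinct roots.\<close>
  have "card Z \<le> size (roots P)"
    unfolding Z by (metis size_mset_mono size_mset_set mset_set_set_mset_msubset)
  also have "\<dots> \<le> m"
    using size_roots_le_degree[OF P] assms by (simp add: P_def)
  finally show ?thesis by (simp add: Z)
qed

text \<open>The fixed points are the roots of \<open>X ^ q - X\<close>, which splits over an
  algebraically closed field; as its roots are simple, their number is the degree
  \<open>q\<close>.\<close>

lemma (in algebraically_closed) card_frobenius_fixed:
  fixes p n :: nat
  assumes p: "Factorial_Ring.prime p" and n: "n > 0" and char: "add_pow L p \<one> = \<zero>"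
  shows "card {x \<in> carrier L. x [^] (p ^ n) = x} = p ^ n"
proof -
  define q where "q = p ^ n"
  have q: "q \<ge> 2"
    using prime_ge_2_nat[OF p] n unfolding q_def by (metis le_trans self_le_power one_le_numeral)
  let ?U = "poly_ring L"
  interpret U: domain ?U
    using univ_poly_is_domain[OF carrier_is_subring] .
  have const: "poly_of_const \<in> ring_hom L ?U"
    using canonical_embedding_is_hom[OF carrier_is_subring] by simp
  interpret C: ring_hom_ring L ?U poly_of_const
    by (rule ring_hom_ringI2[OF ring_axioms U.ring_axioms const])
  \<comment> \<open>Characteristic \<open>p\<close> passes to the polynomial ring, so Frobenius
    powers are additive there too.\<close>
  have charU: "add_pow ?U p \<one>\<^bsub>?U\<^esub> = \<zero>\<^bsub>?U\<^esub>"
    using char C.hom_add_pow[of \<one> p] by simp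
  define P where "P = X [^]\<^bsub>?U\<^esub> q \<ominus>\<^bsub>?U\<^esub> X"
  have X: "X \<in> carrier ?U" using var_closed[OF carrier_is_subring] by simp
  then have P: "P \<in> carrier ?U" by (simp add: P_def)
  have degX: "degree (X [^]\<^bsub>?U\<^esub> q) = q"
    using polynomial_pow_degree[OF X, of q] by (simp add: var_def)
  have deg: "degree P = q"
  proof -
    have "degree (\<ominus>\<^bsub>?U\<^esub> X) = 1"
      using univ_poly_a_inv_degree[OF carrier_is_subring X] by (simp add: var_def)
    then show ?thesis
      using poly_add_degree_eq[of "carrier L" "X [^]\<^bsub>?U\<^esub> q" "\<ominus>\<^bsub>?U\<^esub> X"] q X degX carrier_is_subring
      unfolding P_def a_minus_def univ_poly_add univ_poly_carrier by auto
  qed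
  then have P0: "P \<noteq> []" using q by auto
  have root: "is_root P x \<longleftrightarrow> x \<in> carrier L \<and> x [^] q = x" for x
  proof (cases "x \<in> carrier L")
    case True
    interpret E: ring_hom_ring ?U L "\<lambda>f. eval f x"
      by (rule eval_ring_hom[OF carrier_is_subring True])
    have "eval P x = x [^] q \<ominus> x"
      using X True E.hom_nat_pow[OF X] by (simp add: P_def a_minus_def eval_var)
    then show ?thesis using True P0 by (simp add: is_root_def)
  qed (simp add: is_root_def)
  \<comment> \<open>By Frobenius, \<open>P = D ^ q - D\<close> for \<open>D = X - x\<close>, which is not divisible by \<open>D ^ 2\<close>.\<close>
  have simple: "count (roots P) x \<le> 1" for x
  proof (rule ccontr)
    assume "\<not> count (roots P) x \<le> 1"
    then have mult: "2 \<le> alg_mult P x"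
      using alg_mult_eq_count_roots[OF P] by auto
    then have "is_root P x" using alg_mult_gt_zero_iff_is_root[OF P] by force
    then have x: "x \<in> carrier L" and xq: "x [^] q = x" using root by auto
    define D where "D = [\<one>, \<ominus> x]"
    define A where "A = poly_of_const x"
    have D: "D \<in> carrier ?U"
      using x by (auto simp: D_def univ_poly_carrier[symmetric] polynomial_def)
    have A: "A \<in> carrier ?U" using x by (simp add: A_def)
    have DA: "X = D \<oplus>\<^bsub>?U\<^esub> A"
      using x by (auto simp: A_def D_def univ_poly_add poly_of_const_def var_def l_neg)
    have "X [^]\<^bsub>?U\<^esub> q = D [^]\<^bsub>?U\<^esub> q \<oplus>\<^bsub>?U\<^esub> A [^]\<^bsub>?U\<^esub> q"
      unfolding DA q_def using p charU D A by (rule U.frobenius_pow_add)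
    moreover have "A [^]\<^bsub>?U\<^esub> q = A"
      unfolding A_def using C.hom_nat_pow[OF x, of q] xq by simp
    ultimately have PD: "P = D [^]\<^bsub>?U\<^esub> q \<ominus>\<^bsub>?U\<^esub> D"
      unfolding P_def DA using D A U.nat_pow_closed[OF D, of q] by algebra
    have "D [^]\<^bsub>?U\<^esub> (2::nat) pdivides P"
      using le_alg_mult_imp_pdivides[OF x P mult] by (simp add: D_def)
    then obtain r where r: "r \<in> carrier ?U" "P = D [^]\<^bsub>?U\<^esub> (2::nat) \<otimes>\<^bsub>?U\<^esub> r"
      unfolding pdivides_def by blast
    have "D [^]\<^bsub>?U\<^esub> q = D [^]\<^bsub>?U\<^esub> (2::nat) \<otimes>\<^bsub>?U\<^esub> D [^]\<^bsub>?U\<^esub> (q - 2)"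
      using U.nat_pow_mult[OF D, of 2 "q - 2"] le_add_diff_inverse[OF q] by presburger
    \<comment> \<open>Both \<open>P\<close> and \<open>D ^ q\<close> are multiples of
      \<open>D ^ 2\<close>, hence so is their difference \<open>D\<close>, which has degree only
      1.\<close>
    then have "D = D [^]\<^bsub>?U\<^esub> (2::nat) \<otimes>\<^bsub>?U\<^esub> (D [^]\<^bsub>?U\<^esub> (q - 2) \<ominus>\<^bsub>?U\<^esub> r)"
      using PD r D U.nat_pow_closed[OF D, of "q - 2"] U.nat_pow_closed[OF D, of 2] by algebra
    then have "D [^]\<^bsub>?U\<^esub> (2::nat) pdivides D"
      unfolding pdivides_def using r D by (metis U.minus_closed U.nat_pow_closed dividesI)
    then have "degree (D [^]\<^bsub>?U\<^esub> (2::nat)) \<le> degree D"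
      using D by (intro pdivides_imp_degree_le[OF carrier_is_subring]) (auto simp: D_def)
    then show False
      using polynomial_pow_degree[OF D, of 2] by (simp add: D_def)
  qed
  have "{x \<in> carrier L. x [^] q = x} = set_mset (roots P)"
    using root roots_mem_iff_is_root[OF P] by auto
  \<comment> \<open>Multiplicities at most one make the multiset of roots equal to its underlying
    set, so size and cardinality agree.\<close>
  moreover have "mset_set (set_mset (roots P)) = roots P"
    by (rule multiset_eqI) (metis simple count_mset_set(1,3) count_eq_zero_iff finite_set_mset le_antisym less_one not_less)
  then have "card (set_mset (roots P)) = size (roots P)"
    by (metis size_mset_set)
  moreover have "size (roots P) = q"
    using roots_over_carrier[OF P] deg by (simp add: splitted_def)
  ultimately show ?thesis by (simp add: q_def)
qed

text \<open>The field is the fixed set of the \<open>p ^ n\<close>-th power map in an algebraic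
  closure of the integers modulo \<open>p\<close>; the carrier type is the one on which that closure
  is built.\<close>

lemma exists_field_of_prime_power_order:
  fixes p n :: nat
  assumes p: "Factorial_Ring.prime p" and n: "n > 0"
  obtains F :: "((int list \<times> nat) multiset \<Rightarrow> int) ring"
  where "field F" "card (carrier F) = p ^ n" "add_pow F p \<one>\<^bsub>F\<^esub> = \<zero>\<^bsub>F\<^esub>"
proof -
  interpret Z: residues_prime p "residue_ring (int p)"
    by unfold_locales (use p in simp_all)
  obtain L :: "((int list \<times> nat) multiset \<Rightarrow> int) ring"
    where L: "algebraic_closure L (Z.indexed_const ` carrier (residue_ring (int p)))"
      and hom: "Z.indexed_const \<in> ring_hom (residue_ring (int p)) L"
    using Z.exists_closure by blast
  interpret L: algebraic_closure L "Z.indexed_const ` carrier (residue_ring (int p))"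
    by (rule L)
  interpret C: ring_hom_ring "residue_ring (int p)" L Z.indexed_const
    by (rule ring_hom_ringI2[OF Z.ring_axioms L.ring_axioms hom])
  have "add_pow (residue_ring (int p)) k \<one>\<^bsub>residue_ring (int p)\<^esub> = int k mod int p" for k :: nat
    by (induction k) (simp_all add: Z.res_zero_eq Z.res_one_eq Z.res_add_eq mod_simps add.commute)
  then have char: "add_pow L p \<one>\<^bsub>L\<^esub> = \<zero>\<^bsub>L\<^esub>"
    using C.hom_add_pow[of "\<one>\<^bsub>residue_ring (int p)\<^esub>" p] by (simp add: Z.res_zero_eq[symmetric])
  define K where "K = {x \<in> carrier L. x [^]\<^bsub>L\<^esub> (p ^ n) = x}"
  have q0: "p ^ n \<noteq> 0" using p by auto
  \<comment> \<open>Additivity is applied to \<open>x\<close> and its negative, so even and odd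
    \<open>p\<close> are treated alike; the exponent is nonzero, so zero is sent to zero.\<close>
  have neg: "(\<ominus>\<^bsub>L\<^esub> x) [^]\<^bsub>L\<^esub> (p ^ n) = \<ominus>\<^bsub>L\<^esub> (x [^]\<^bsub>L\<^esub> (p ^ n))" if "x \<in> carrier L" for x
    using L.frobenius_pow_add[OF p char that L.a_inv_closed[OF that], of n] that q0
    by (metis L.a_inv_closed L.minus_equality L.nat_pow_closed L.nat_pow_zero L.r_neg L.a_comm)
  have "subfield K L"
  proof (rule L.subfieldI')
    show "subring K L"
      by (rule L.subringI)
        (auto simp: K_def neg L.frobenius_pow_add[OF p char] L.nat_pow_distrib)
    fix k assume k: "k \<in> K - {\<zero>\<^bsub>L\<^esub>}"
    then have u: "k \<in> Units L" by (auto simp: K_def L.field_Units)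
    then have i: "inv\<^bsub>L\<^esub> k \<in> carrier L" by simp
    \<comment> \<open>The first factor \<open>k\<close> equals its own power, since it lies in
      \<open>K\<close>.\<close>
    have "k \<otimes>\<^bsub>L\<^esub> (inv\<^bsub>L\<^esub> k) [^]\<^bsub>L\<^esub> (p ^ n) = (k \<otimes>\<^bsub>L\<^esub> inv\<^bsub>L\<^esub> k) [^]\<^bsub>L\<^esub> (p ^ n)"
      using k i by (simp add: L.nat_pow_distrib K_def)
    also have "\<dots> = \<one>\<^bsub>L\<^esub>" using u by simp
    finally have "(inv\<^bsub>L\<^esub> k) [^]\<^bsub>L\<^esub> (p ^ n) = inv\<^bsub>L\<^esub> k"
      using u i by (metis L.Units_closed L.comm_inv_char L.nat_pow_closed)
    then show "inv\<^bsub>L\<^esub> k \<in> K" using i by (simp add: K_def)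
  qed
  then have "field (L\<lparr>carrier := K\<rparr>)" by (rule L.subfield_iff)
  moreover have "card (carrier (L\<lparr>carrier := K\<rparr>)) = p ^ n"
    using L.card_frobenius_fixed[OF p n char] by (simp add: K_def)
  moreover have "add_pow (L\<lparr>carrier := K\<rparr>) p \<one>\<^bsub>L\<lparr>carrier := K\<rparr>\<^esub> = \<zero>\<^bsub>L\<lparr>carrier := K\<rparr>\<^esub>"
    using char by (simp add: add_pow_def nat_pow_def)
  ultimately show thesis by (rule that)
qed

section \<open>Groups with large commutator sets\<close>

context group
begin

lemma coset_mult_eq_iff:
  assumes "subgroup M G" "z \<in> carrier G" "x \<in> carrier G"
  shows "M #> (z \<otimes> x) = M #> x \<longleftrightarrow> z \<in> M"
proof
  assume "M #> (z \<otimes> x) = M #> x"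
  then have "M #> (z \<otimes> x \<otimes> inv x) = M"
    using assms by (intro coset_mult_inv2) (auto dest: subgroup.subset)
  then show "z \<in> M"
    using assms by (simp add: m_assoc coset_join1)
next
  assume "z \<in> M"
  then have "M #> z = M" using assms coset_join2 by blast
  then show "M #> (z \<otimes> x) = M #> x"
    using assms by (metis coset_mult_assoc subgroup.subset)
qed

text \<open>Commutators are expressed by \<open>x y = z (y x)\<close>, free of inverses; modulo
  \<open>M\<close> the factor \<open>z\<close> disappears.\<close>

lemma elementary_abelian_FactGroup:
  assumes M: "M \<lhd> G"
    and comm: "\<And>x y. x \<in> carrier G \<Longrightarrow> y \<in> carrier G \<Longrightarrow> \<exists>z \<in> M. x \<otimes> y = z \<otimes> (y \<otimes> x)"
    and pow: "\<And>x. x \<in> carrier G \<Longrightarrow> x [^] p \<in> M"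
  shows "elementary_abelian p (G Mod M)"
proof -
  interpret normal M G by (rule M)
  have eq: "M #> (x \<otimes> y) = M #> (y \<otimes> x)" if "x \<in> carrier G" "y \<in> carrier G" for x y
  proof -
    obtain z where "z \<in> M" "x \<otimes> y = z \<otimes> (y \<otimes> x)"
      using comm[of x y] \<open>x \<in> carrier G\<close> \<open>y \<in> carrier G\<close> by auto
    then show ?thesis using that coset_mult_eq_iff[OF subgroup_axioms, of z "y \<otimes> x"] subset
      by auto
  qed
  interpret Q: group "G Mod M" by (rule factorgroup_is_group)
  have "comm_group (G Mod M)"
    by (rule Q.group_comm_groupI) (auto simp: carrier_FactGroup rcos_sum eq)
  moreover have "V [^]\<^bsub>G Mod M\<^esub> p = \<one>\<^bsub>G Mod M\<^esub>" if "V \<in> carrier (G Mod M)" for V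
    using that pow subgroup_axioms by (auto simp: carrier_FactGroup FactGroup_pow coset_join2)
  ultimately show ?thesis by (simp add: elementary_abelian_def)
qed

lemma group_center_subset: "group_center G \<subseteq> carrier G"
  by (auto simp: group_center_def)

lemma group_center_mult_closed:
  assumes "x \<in> group_center G" "y \<in> group_center G"
  shows "x \<otimes> y \<in> group_center G"
  unfolding group_center_def
proof (intro CollectI conjI ballI)
  fix g assume "g \<in> carrier G"
  moreover from this have "x \<in> carrier G" "y \<in> carrier G" "x \<otimes> g = g \<otimes> x" "y \<otimes> g = g \<otimes> y"
    using assms by (auto simp: group_center_def)
  ultimately show "x \<otimes> y \<otimes> g = g \<otimes> (x \<otimes> y)"
    by (metis m_assoc)
qed (use assms group_center_subset in auto)

lemma group_center_subgroup: "subgroup (group_center G) G"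
proof (rule subgroupI)
  show "inv z \<in> group_center G" if "z \<in> group_center G" for z
    unfolding group_center_def
  proof (intro CollectI conjI ballI)
    fix g assume g: "g \<in> carrier G"
    have z: "z \<in> carrier G" using that by (simp add: group_center_def)
    have "inv (z \<otimes> inv g) = inv (inv g \<otimes> z)" using that g by (simp add: group_center_def)
    then show "inv z \<otimes> g = g \<otimes> inv z" using z g by (simp add: inv_mult_group)
  qed (use that in \<open>simp add: group_center_def\<close>)
  show "group_center G \<noteq> {}"
    by (auto simp: group_center_def intro!: exI[of _ \<one>])
qed (use group_center_subset group_center_mult_closed in auto)

lemma central_subgroup_normal:
  assumes "subgroup N G" "N \<subseteq> group_center G"
  shows "N \<lhd> G"
  unfolding normal_inv_iff
proof (intro conjI ballI)
  fix x h assume x: "x \<in> carrier G" and h: "h \<in> N"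
  then have "h \<in> carrier G" "x \<otimes> h = h \<otimes> x" using assms by (auto simp: group_center_def)
  then show "x \<otimes> h \<otimes> inv x \<in> N" using x h by (simp add: m_assoc)
qed (rule assms)

text \<open>The commutators of a noncentral \<open>x\<close> fill the whole centre. If its coset
  were central modulo \<open>N\<close>, all of them would lie in \<open>N\<close>, forcing
  \<open>N\<close> to be the full centre.\<close>

lemma group_center_FactGroup:
  assumes N: "subgroup N G" "N \<subseteq> group_center G" "N \<noteq> group_center G"
    and onto: "\<And>x z. x \<in> carrier G \<Longrightarrow> x \<notin> group_center G \<Longrightarrow> z \<in> group_center G
      \<Longrightarrow> \<exists>y \<in> carrier G. x \<otimes> y = z \<otimes> (y \<otimes> x)"
    and x: "x \<in> carrier G"
  shows "N #> x \<in> group_center (G Mod N) \<longleftrightarrow> x \<in> group_center G"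
proof -
  interpret normal N G by (rule central_subgroup_normal[OF N(1,2)])
  have iff: "N #> x \<in> group_center (G Mod N) \<longleftrightarrow> (\<forall>y \<in> carrier G. N #> (x \<otimes> y) = N #> (y \<otimes> x))"
    using x by (auto simp: group_center_def carrier_FactGroup rcos_sum)
  show ?thesis
  proof
    assume c: "N #> x \<in> group_center (G Mod N)"
    show "x \<in> group_center G"
    proof (rule ccontr)
      assume nx: "x \<notin> group_center G"
      have "z \<in> N" if z: "z \<in> group_center G" for z
      proof -
        obtain y where y: "y \<in> carrier G" "x \<otimes> y = z \<otimes> (y \<otimes> x)"
          using onto[OF x nx z] by blast
        then show ?thesis
          using c iff coset_mult_eq_iff[OF subgroup_axioms, of z "y \<otimes> x"] x
            subsetD[OF group_center_subset z]
          by auto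
      qed
      then show False using N by blast
    qed
  qed (use iff in \<open>auto simp: group_center_def\<close>)
qed

text \<open>For \<open>N\<close> of index \<open>p\<close> in the centre \<open>Z\<close>, the
  centre of \<open>G / N\<close> is \<open>Z / N\<close>, of order \<open>p\<close>. The conditions
  on commutators and \<open>p\<close>-th powers pass to the quotient and make its central quotient
  elementary abelian.\<close>

lemma semi_extraspecialI:
  assumes p: "Factorial_Ring.prime p" and ord: "order G = p ^ k"
    and comm: "\<And>x y. x \<in> carrier G \<Longrightarrow> y \<in> carrier G
      \<Longrightarrow> \<exists>z \<in> group_center G. x \<otimes> y = z \<otimes> (y \<otimes> x)"
    and pow: "\<And>x. x \<in> carrier G \<Longrightarrow> x [^] p \<in> group_center G"
    and onto: "\<And>x z. x \<in> carrier G \<Longrightarrow> x \<notin> group_center G \<Longrightarrow> z \<in> group_center G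
      \<Longrightarrow> \<exists>y \<in> carrier G. x \<otimes> y = z \<otimes> (y \<otimes> x)"
    and nonabelian: "group_center G \<noteq> carrier G"
  shows "semi_extraspecial p G"
proof -
  let ?Z = "group_center G"
  have "order G \<noteq> 0" using ord p by auto
  then have fin: "finite (carrier G)" by (simp add: order_def card_eq_0_iff)
  have fpG: "finite_p_group p G"
    unfolding finite_p_group_def using p ord fin is_group by auto
  have "extraspecial p (G Mod N)"
    if sub: "subgroup N (G\<lparr>carrier := ?Z\<rparr>)" and idx: "subgroup_index (G\<lparr>carrier := ?Z\<rparr>) N = p" for N
  proof -
    have N: "subgroup N G" "N \<subseteq> ?Z"
      using incl_subgroup[OF group_center_subgroup sub] subgroup.subset[OF sub] by auto
    interpret normal N G by (rule central_subgroup_normal[OF N])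
    interpret Q: group "G Mod N" by (rule factorgroup_is_group)
    \<comment> \<open>Cosets of \<open>N\<close> taken inside the centre and in \<open>G\<close> are
      the same sets, so the index is the order of the image of the centre.\<close>
    have index: "card ((\<lambda>z. N #> z) ` ?Z) = p"
      using idx by (simp add: subgroup_index_def RCOSETS_def r_coset_def UNION_singleton_eq_range)
    have "N \<noteq> ?Z"
    proof
      assume "N = ?Z"
      then have "(\<lambda>z. N #> z) ` ?Z = {N}"
        using coset_join2[OF _ N(1)] N(1) subgroup.one_closed[OF N(1)] group_center_subset
        by (auto simp: image_iff)
      then show False using index p by auto
    qed
    note center = group_center_FactGroup[OF N this onto]
    have centerQ: "group_center (G Mod N) = (\<lambda>z. N #> z) ` ?Z"
    proof
      show "group_center (G Mod N) \<subseteq> (\<lambda>z. N #> z) ` ?Z"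
      proof
        fix V assume V: "V \<in> group_center (G Mod N)"
        then obtain x where "x \<in> carrier G" "V = N #> x"
          by (auto simp: group_center_def carrier_FactGroup)
        then show "V \<in> (\<lambda>z. N #> z) ` ?Z" using V center by auto
      qed
    qed (use center group_center_subset in auto)
    have "card (rcosets N) * card N = p ^ k"
      using lagrange[OF N(1)] ord by simp
    then have "order (G Mod N) dvd p ^ k"
      by (metis FactGroup_def dvd_triv_left order_def partial_object.simps(1))
    then have "\<exists>i. order (G Mod N) = p ^ i"
      using p by (auto simp: divides_primepow_nat)
    then have fpQ: "finite_p_group p (G Mod N)"
      using p fin by (auto simp: finite_p_group_def carrier_FactGroup Q.is_group)
    have ZQ: "group_center (G Mod N) \<lhd> G Mod N"
      using Q.central_subgroup_normal Q.group_center_subgroup by blast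
    have elem: "elementary_abelian p (G Mod N Mod group_center (G Mod N))"
    proof (rule Q.elementary_abelian_FactGroup[OF ZQ])
      fix V W assume "V \<in> carrier (G Mod N)" "W \<in> carrier (G Mod N)"
      then obtain x y where xy: "x \<in> carrier G" "y \<in> carrier G" and V: "V = N #> x" "W = N #> y"
        by (auto simp: carrier_FactGroup)
      obtain z where z: "z \<in> ?Z" and e: "x \<otimes> y = z \<otimes> (y \<otimes> x)" using comm xy by blast
      have "N #> (x \<otimes> y) = (N #> z) <#> (N #> (y \<otimes> x))"
        unfolding e using z xy group_center_subset by (subst rcos_sum) auto
      then show "\<exists>U \<in> group_center (G Mod N). V \<otimes>\<^bsub>G Mod N\<^esub> W = U \<otimes>\<^bsub>G Mod N\<^esub> (W \<otimes>\<^bsub>G Mod N\<^esub> V)"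
        using z xy by (auto simp: centerQ V rcos_sum)
    next
      fix V assume "V \<in> carrier (G Mod N)"
      then show "V [^]\<^bsub>G Mod N\<^esub> p \<in> group_center (G Mod N)"
        using pow by (auto simp: carrier_FactGroup FactGroup_pow centerQ)
    qed
    \<comment> \<open>Order 1 would make \<open>G / N\<close> equal to its centre, and pulling back
      through \<open>center\<close> would make \<open>G\<close> abelian.\<close>
    have "order (G Mod N Mod group_center (G Mod N)) \<noteq> 1"
    proof
      assume 1: "order (G Mod N Mod group_center (G Mod N)) = 1"
      have "order (G Mod N Mod group_center (G Mod N)) * card (group_center (G Mod N)) = order (G Mod N)"
        using Q.lagrange[OF Q.group_center_subgroup] by (simp add: FactGroup_def order_def)
      then have "card (group_center (G Mod N)) = card (carrier (G Mod N))"
        using 1 by (simp add: order_def)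
      then have "group_center (G Mod N) = carrier (G Mod N)"
        using fpQ Q.group_center_subset unfolding finite_p_group_def by (meson card_subset_eq)
      then have "carrier G \<subseteq> ?Z" using center by (auto simp: carrier_FactGroup)
      then show False using nonabelian group_center_subset by blast
    qed
    then show ?thesis
      unfolding extraspecial_def using fpQ elem index by (simp add: centerQ)
  qed
  then show ?thesis unfolding semi_extraspecial_def using fpG by blast
qed

text \<open>One noncentral element already yields every central element as a single commutator;
  conversely all commutators are central.\<close>

lemma derived_eq_group_center:
  assumes comm: "\<And>x y. x \<in> carrier G \<Longrightarrow> y \<in> carrier G
      \<Longrightarrow> \<exists>z \<in> group_center G. x \<otimes> y = z \<otimes> (y \<otimes> x)"
    and onto: "\<And>x z. x \<in> carrier G \<Longrightarrow> x \<notin> group_center G \<Longrightarrow> z \<in> group_center G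
      \<Longrightarrow> \<exists>y \<in> carrier G. x \<otimes> y = z \<otimes> (y \<otimes> x)"
    and nonabelian: "group_center G \<noteq> carrier G"
  shows "derived G (carrier G) = group_center G"
proof -
  have commutator: "x \<otimes> y \<otimes> inv x \<otimes> inv y = z"
    if "x \<in> carrier G" "y \<in> carrier G" "z \<in> carrier G" "x \<otimes> y = z \<otimes> (y \<otimes> x)" for x y z
    using that by (simp add: m_assoc)
  have "derived_set G (carrier G) \<subseteq> group_center G"
    using comm commutator group_center_subset by (auto, metis subsetD)
  then have "derived G (carrier G) \<subseteq> group_center G"
    unfolding derived_def using group_center_subgroup by (rule generate_subgroup_incl)
  moreover have "group_center G \<subseteq> derived G (carrier G)"
  proof
    fix z assume z: "z \<in> group_center G"
    obtain x where x: "x \<in> carrier G" "x \<notin> group_center G"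
      using nonabelian group_center_subset by blast
    then obtain y where y: "y \<in> carrier G" "x \<otimes> y = z \<otimes> (y \<otimes> x)"
      using onto z by blast
    then have "z = x \<otimes> y \<otimes> inv x \<otimes> inv y"
      using x z group_center_subset commutator by (metis subsetD)
    then show "z \<in> derived G (carrier G)"
      unfolding derived_def using x(1) y(1) by (intro generate.incl) blast
  qed
  ultimately show ?thesis by blast
qed

end

section \<open>Twisted Heisenberg groups\<close>

text \<open>The coding \<open>e\<close> only serves to place the group on a prescribed carrier type.\<close>

definition (in field) encoded_triples :: "('a \<times> 'a \<times> 'a \<Rightarrow> 'c) \<Rightarrow> ('a \<Rightarrow> 'a \<Rightarrow> 'a) \<Rightarrow> 'c monoid" where
  "encoded_triples e g =
     (let D = carrier R \<times> carrier R \<times> carrier R in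
      \<lparr>carrier = e ` D,
       monoid.mult = (\<lambda>x y. case (inv_into D e x, inv_into D e y) of
         ((a, b, c), (a', b', c')) \<Rightarrow> e (a \<oplus> a', b \<oplus> b', c \<oplus> c' \<oplus> (a \<otimes> b' \<oplus> g a a'))),
       one = e (\<zero>, \<zero>, \<zero>)\<rparr>)"

text \<open>Biadditivity of \<open>g\<close> gives associativity. Only additivity, not linearity
  over \<open>R\<close>, is asked in each argument, because the eventual \<open>g\<close> is a
  product of Frobenius powers.\<close>

locale twisted_heisenberg = field +
  fixes e :: "'a \<times> 'a \<times> 'a \<Rightarrow> 'c" and g :: "'a \<Rightarrow> 'a \<Rightarrow> 'a"
  assumes inj: "inj_on e (carrier R \<times> carrier R \<times> carrier R)"
    and g_closed [simp]: "x \<in> carrier R \<Longrightarrow> y \<in> carrier R \<Longrightarrow> g x y \<in> carrier R"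
    and g_add_left: "x \<in> carrier R \<Longrightarrow> y \<in> carrier R \<Longrightarrow> z \<in> carrier R \<Longrightarrow> g (x \<oplus> y) z = g x z \<oplus> g y z"
    and g_add_right: "x \<in> carrier R \<Longrightarrow> y \<in> carrier R \<Longrightarrow> z \<in> carrier R \<Longrightarrow> g x (y \<oplus> z) = g x y \<oplus> g x z"
begin

abbreviation H :: "'c monoid" where "H \<equiv> encoded_triples e g"

lemma carrier_H: "carrier H = e ` (carrier R \<times> carrier R \<times> carrier R)"
  by (simp add: encoded_triples_def Let_def)

lemma one_H: "\<one>\<^bsub>H\<^esub> = e (\<zero>, \<zero>, \<zero>)"
  by (simp add: encoded_triples_def Let_def)

lemma mem_H [simp]: "a \<in> carrier R \<Longrightarrow> b \<in> carrier R \<Longrightarrow> c \<in> carrier R \<Longrightarrow> e (a, b, c) \<in> carrier H"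
  by (auto simp: carrier_H)

lemma H_cases:
  assumes "x \<in> carrier H"
  obtains a b c where "a \<in> carrier R" "b \<in> carrier R" "c \<in> carrier R" "x = e (a, b, c)"
  using assms by (auto simp: carrier_H)

lemma e_eq_iff [simp]:
  assumes "a \<in> carrier R" "b \<in> carrier R" "c \<in> carrier R"
    "a' \<in> carrier R" "b' \<in> carrier R" "c' \<in> carrier R"
  shows "e (a, b, c) = e (a', b', c') \<longleftrightarrow> a = a' \<and> b = b' \<and> c = c'"
  using inj_on_eq_iff[OF inj, of "(a, b, c)" "(a', b', c')"] assms by simp

lemma mult_H [simp]:
  assumes "a \<in> carrier R" "b \<in> carrier R" "c \<in> carrier R"
    "a' \<in> carrier R" "b' \<in> carrier R" "c' \<in> carrier R"
  shows "e (a, b, c) \<otimes>\<^bsub>H\<^esub> e (a', b', c') = e (a \<oplus> a', b \<oplus> b', c \<oplus> c' \<oplus> (a \<otimes> b' \<oplus> g a a'))"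
  using assms inv_into_f_f[OF inj] by (simp add: encoded_triples_def Let_def)

lemma g_zero_left [simp]: "x \<in> carrier R \<Longrightarrow> g \<zero> x = \<zero>"
  using g_add_left[of \<zero> \<zero> x] by simp

lemma g_zero_right [simp]: "x \<in> carrier R \<Longrightarrow> g x \<zero> = \<zero>"
  using g_add_right[of x \<zero> \<zero>] by simp

lemma g_neg_left: 
  assumes "x \<in> carrier R" "y \<in> carrier R"
  shows "g (\<ominus> x) y = \<ominus> g x y"
proof -
  have "g (\<ominus> x) y \<oplus> g x y = \<zero>"
    using g_add_left[of "\<ominus> x" x y] assms by (simp add: l_neg)
  then show ?thesis using assms by (simp add: minus_equality)
qed

lemma group_H: "group H"
proof (rule groupI)
  fix x y z assume "x \<in> carrier H" "y \<in> carrier H" "z \<in> carrier H"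
  then show "x \<otimes>\<^bsub>H\<^esub> y \<otimes>\<^bsub>H\<^esub> z = x \<otimes>\<^bsub>H\<^esub> (y \<otimes>\<^bsub>H\<^esub> z)"
    by (elim H_cases) (simp add: g_add_left g_add_right l_distr r_distr a_ac)
next
  fix x assume "x \<in> carrier H"
  then show "\<exists>y \<in> carrier H. y \<otimes>\<^bsub>H\<^esub> x = \<one>\<^bsub>H\<^esub>"
  proof (cases rule: H_cases)
    case (1 a b c)
    \<comment> \<open>Third coordinate of a left inverse: moving the sign out of \<open>g\<close>
      turns the twist of \<open>- a\<close> with \<open>a\<close> into the negative of
      \<open>a b + g a a\<close>, which \<open>d\<close> cancels.\<close>
    define d where "d = \<ominus> c \<oplus> (a \<otimes> b \<oplus> g a a)"
    have "d \<oplus> c \<oplus> (\<ominus> a \<otimes> b \<oplus> g (\<ominus> a) a) = \<zero>"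
      using 1 g_closed[of a a] unfolding d_def g_neg_left[OF 1(1,1)] by algebra
    then have "e (\<ominus> a, \<ominus> b, d) \<otimes>\<^bsub>H\<^esub> x = \<one>\<^bsub>H\<^esub>"
      using 1 by (simp add: one_H l_neg d_def)
    moreover have "e (\<ominus> a, \<ominus> b, d) \<in> carrier H" using 1 by (simp add: d_def)
    ultimately show ?thesis by blast
  qed
next
  show "\<one>\<^bsub>H\<^esub> \<in> carrier H" by (simp add: one_H)
qed (auto simp: one_H elim!: H_cases)

sublocale H: group H by (rule group_H)

section \<open>Commutators, centre and ultraspeciality\<close>

definition commutator_form :: "'a \<Rightarrow> 'a \<Rightarrow> 'a \<Rightarrow> 'a \<Rightarrow> 'a" where
  "commutator_form a b a' b' = (a \<otimes> b' \<oplus> g a a') \<ominus> (a' \<otimes> b \<oplus> g a' a)"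

text \<open>The first two coordinates of both sides agree because addition commutes, and in the
  third \<open>c\<close> and \<open>c'\<close> cancel. This turns the inverse-free commutator
  relation into an equation in the field.\<close>

lemma mult_eq_central_mult_iff:
  assumes "a \<in> carrier R" "b \<in> carrier R" "c \<in> carrier R"
    "a' \<in> carrier R" "b' \<in> carrier R" "c' \<in> carrier R" "w \<in> carrier R"
  shows "e (a, b, c) \<otimes>\<^bsub>H\<^esub> e (a', b', c') = e (\<zero>, \<zero>, w) \<otimes>\<^bsub>H\<^esub> (e (a', b', c') \<otimes>\<^bsub>H\<^esub> e (a, b, c))
    \<longleftrightarrow> commutator_form a b a' b' = w"
proof -
  define u v where "u = a \<otimes> b' \<oplus> g a a'" and "v = a' \<otimes> b \<oplus> g a' a"
  have uv: "u \<in> carrier R" "v \<in> carrier R" using assms by (simp_all add: u_def v_def)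
  have "c \<oplus> c' \<oplus> u = w \<oplus> (c' \<oplus> c \<oplus> v) \<longleftrightarrow> u \<ominus> v = w"
  proof
    assume eq: "c \<oplus> c' \<oplus> u = w \<oplus> (c' \<oplus> c \<oplus> v)"
    have "u \<ominus> v = (c \<oplus> c' \<oplus> u) \<ominus> (c' \<oplus> c \<oplus> v)" using assms uv by algebra
    also have "\<dots> = w" unfolding eq using assms uv by algebra
    finally show "u \<ominus> v = w" .
  next
    assume "u \<ominus> v = w"
    moreover have "u = (u \<ominus> v) \<oplus> v" using uv by algebra
    ultimately have "u = w \<oplus> v" by simp
    then show "c \<oplus> c' \<oplus> u = w \<oplus> (c' \<oplus> c \<oplus> v)" using assms uv by algebra
  qed
  then show ?thesis
    using assms uv by (simp add: commutator_form_def u_def[symmetric] v_def[symmetric] a_comm)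
qed

lemma commute_iff:
  assumes "a \<in> carrier R" "b \<in> carrier R" "c \<in> carrier R"
    "a' \<in> carrier R" "b' \<in> carrier R" "c' \<in> carrier R"
  shows "e (a, b, c) \<otimes>\<^bsub>H\<^esub> e (a', b', c') = e (a', b', c') \<otimes>\<^bsub>H\<^esub> e (a, b, c)
    \<longleftrightarrow> commutator_form a b a' b' = \<zero>"
  using mult_eq_central_mult_iff[OF assms zero_closed] H.l_one[of "e (a', b', c') \<otimes>\<^bsub>H\<^esub> e (a, b, c)"] assms
  by (simp only: one_H H.m_closed mem_H)

lemma commutator_form_closed [simp]:
  assumes "a \<in> carrier R" "b \<in> carrier R" "a' \<in> carrier R" "b' \<in> carrier R"
  shows "commutator_form a b a' b' \<in> carrier R"
  using assms by (simp add: commutator_form_def)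

text \<open>Setting \<open>a' = 0\<close> or \<open>b' = 0\<close> makes the twist vanish or leaves
  a one-term equation: if \<open>a\<close> is nonzero, \<open>a b' = w\<close> is solved for
  \<open>b'\<close>; otherwise \<open>- a' b = w\<close> is solved for \<open>a'\<close>.\<close>

lemma commutator_form_onto:
  assumes "a \<in> carrier R" "b \<in> carrier R" "w \<in> carrier R" "a \<noteq> \<zero> \<or> b \<noteq> \<zero>"
  obtains a' b' where "a' \<in> carrier R" "b' \<in> carrier R" "commutator_form a b a' b' = w"
proof (cases "a = \<zero>")
  case False
  then have u: "inv a \<in> carrier R" "a \<otimes> inv a = \<one>"
    using assms by (auto simp: field_Units)
  have "commutator_form a b \<zero> (inv a \<otimes> w) = w"
    using assms u by (simp add: commutator_form_def m_assoc[symmetric] a_minus_def)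
  then show thesis using u assms by (intro that[of \<zero> "inv a \<otimes> w"]) auto
next
  case True
  then have u: "inv b \<in> carrier R" "inv b \<otimes> b = \<one>"
    using assms by (auto simp: field_Units)
  have "commutator_form a b (\<ominus> (w \<otimes> inv b)) \<zero> = w"
    using assms u True by (simp add: commutator_form_def m_assoc a_minus_def l_minus)
  then show thesis using u assms by (intro that[of "\<ominus> (w \<otimes> inv b)" \<zero>]) auto
qed

lemma central_iff:
  assumes "a \<in> carrier R" "b \<in> carrier R" "c \<in> carrier R"
  shows "e (a, b, c) \<in> group_center H \<longleftrightarrow> a = \<zero> \<and> b = \<zero>"
proof
  assume z: "e (a, b, c) \<in> group_center H"
  show "a = \<zero> \<and> b = \<zero>"
  proof (rule ccontr)
    assume "\<not> (a = \<zero> \<and> b = \<zero>)"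
    \<comment> \<open>A nonzero pair attains the form value one with some partner, whereas commuting
      elements give zero.\<close>
    then obtain a' b' where ab: "a' \<in> carrier R" "b' \<in> carrier R" "commutator_form a b a' b' = \<one>"
      using commutator_form_onto[OF assms(1,2) one_closed] by metis
    then have "e (a, b, c) \<otimes>\<^bsub>H\<^esub> e (a', b', \<zero>) = e (a', b', \<zero>) \<otimes>\<^bsub>H\<^esub> e (a, b, c)"
      using z by (simp add: group_center_def)
    then show False using ab assms by (simp only: commute_iff zero_closed) simp
  qed
next
  assume "a = \<zero> \<and> b = \<zero>"
  then show "e (a, b, c) \<in> group_center H"
    using assms by (auto simp: group_center_def a_comm elim!: H_cases)
qed

lemma group_center_H: "group_center H = (\<lambda>c. e (\<zero>, \<zero>, c)) ` carrier R"
proof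
  show "group_center H \<subseteq> (\<lambda>c. e (\<zero>, \<zero>, c)) ` carrier R"
  proof
    fix x assume x: "x \<in> group_center H"
    then have "x \<in> carrier H" by (simp add: group_center_def)
    then show "x \<in> (\<lambda>c. e (\<zero>, \<zero>, c)) ` carrier R"
      by (cases rule: H_cases) (use x central_iff in auto)
  qed
qed (auto simp: central_iff)

lemma commutator_central:
  assumes "x \<in> carrier H" "y \<in> carrier H"
  shows "\<exists>z \<in> group_center H. x \<otimes>\<^bsub>H\<^esub> y = z \<otimes>\<^bsub>H\<^esub> (y \<otimes>\<^bsub>H\<^esub> x)"
proof -
  obtain a b c where x: "a \<in> carrier R" "b \<in> carrier R" "c \<in> carrier R" "x = e (a, b, c)"
    using assms(1) by (rule H_cases)
  obtain a' b' c' where y: "a' \<in> carrier R" "b' \<in> carrier R" "c' \<in> carrier R" "y = e (a', b', c')"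
    using assms(2) by (rule H_cases)
  have "x \<otimes>\<^bsub>H\<^esub> y = e (\<zero>, \<zero>, commutator_form a b a' b') \<otimes>\<^bsub>H\<^esub> (y \<otimes>\<^bsub>H\<^esub> x)"
    unfolding x y using x y by (subst mult_eq_central_mult_iff) auto
  then show ?thesis using x y by (auto simp: group_center_H)
qed

lemma commutators_onto_center:
  assumes "x \<in> carrier H" "x \<notin> group_center H" "z \<in> group_center H"
  shows "\<exists>y \<in> carrier H. x \<otimes>\<^bsub>H\<^esub> y = z \<otimes>\<^bsub>H\<^esub> (y \<otimes>\<^bsub>H\<^esub> x)"
proof -
  obtain a b c where x: "a \<in> carrier R" "b \<in> carrier R" "c \<in> carrier R" "x = e (a, b, c)"
    using assms(1) by (rule H_cases)
  obtain w where w: "w \<in> carrier R" "z = e (\<zero>, \<zero>, w)"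
    using assms(3) by (auto simp: group_center_H)
  have "a \<noteq> \<zero> \<or> b \<noteq> \<zero>" using assms(2) x by (auto simp: group_center_H)
  then obtain a' b' where y: "a' \<in> carrier R" "b' \<in> carrier R" "commutator_form a b a' b' = w"
    using commutator_form_onto[OF x(1,2) w(1)] by blast
  then have "x \<otimes>\<^bsub>H\<^esub> e (a', b', \<zero>) = z \<otimes>\<^bsub>H\<^esub> (e (a', b', \<zero>) \<otimes>\<^bsub>H\<^esub> x)"
    unfolding x(4) w(2) using mult_eq_central_mult_iff[OF x(1-3) y(1,2) zero_closed w(1)] by blast
  then show ?thesis using mem_H[OF y(1,2) zero_closed] by blast
qed

lemma nonabelian: "group_center H \<noteq> carrier H"
  using central_iff[OF one_closed zero_closed zero_closed] mem_H[OF one_closed zero_closed zero_closed]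
    one_not_zero by metis

text \<open>The third coordinate is left unspecified: centrality of a power depends only on the
  first two.\<close>

lemma pow_H:
  fixes k :: nat
  assumes "a \<in> carrier R" "b \<in> carrier R" "c \<in> carrier R"
  shows "\<exists>c' \<in> carrier R. e (a, b, c) [^]\<^bsub>H\<^esub> k = e (add_pow R k a, add_pow R k b, c')"
proof (induction k)
  case (Suc k)
  then obtain c' where "c' \<in> carrier R" "e (a, b, c) [^]\<^bsub>H\<^esub> k = e (add_pow R k a, add_pow R k b, c')"
    by blast
  then show ?case using assms by auto
qed (auto simp: one_H)

lemma order_H: "order H = card (carrier R) ^ 3"
  by (simp add: order_def carrier_H card_image[OF inj] card_cartesian_product power3_eq_cube)

lemma card_center_H: "card (group_center H) = card (carrier R)"
  unfolding group_center_H by (rule card_image) (auto intro: inj_onI)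

text \<open>Characteristic \<open>p\<close> kills the first two coordinates of a \<open>p\<close>-th
  power. With \<open>q = p ^ n\<close>, the derived subgroup is the centre, of order
  \<open>q\<close>, and its index is \<open>q ^ 2\<close>.\<close>

lemma ultraspecial_H:
  assumes p: "Factorial_Ring.prime p" and card: "card (carrier R) = p ^ n"
    and char: "add_pow R p \<one> = \<zero>"
  shows "ultraspecial p H"
proof -
  have "x [^]\<^bsub>H\<^esub> p \<in> group_center H" if x: "x \<in> carrier H" for x
  proof -
    obtain a b c where abc: "a \<in> carrier R" "b \<in> carrier R" "c \<in> carrier R" "x = e (a, b, c)"
      using x by (rule H_cases)
    then show ?thesis
      using pow_H[of a b c p] add_pow_char_dvd[OF char] by (auto simp: group_center_H)
  qed
  then have "semi_extraspecial p H"
    using p card order_H commutator_central commutators_onto_center nonabelian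
    by (intro H.semi_extraspecialI[of p "n * 3"]) (auto simp: power_mult)
  moreover have derived: "derived H (carrier H) = group_center H"
    using commutator_central commutators_onto_center nonabelian by (rule H.derived_eq_group_center)
  have "subgroup_index H (group_center H) * card (carrier R) = card (carrier R) ^ 2 * card (carrier R)"
    using H.lagrange[OF H.group_center_subgroup]
    by (simp add: subgroup_index_def order_H card_center_H power3_eq_cube power2_eq_square)
  then have "subgroup_index H (group_center H) = card (carrier R) ^ 2"
    using card p by auto
  ultimately show ?thesis
    by (simp add: ultraspecial_def derived card_center_H real_sqrt_pow2)
qed

section \<open>Abelian subgroups of order \<open>q ^ 2\<close>\<close>

definition base_subgroup :: "'c set" where
  "base_subgroup = (\<lambda>(b, c). e (\<zero>, b, c)) ` (carrier R \<times> carrier R)"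

lemma base_subgroup_subgroup: "subgroup base_subgroup H"
proof (rule H.subgroupI)
  fix x assume "x \<in> base_subgroup"
  then obtain b c where x: "b \<in> carrier R" "c \<in> carrier R" "x = e (\<zero>, b, c)"
    by (auto simp: base_subgroup_def)
  then have "inv\<^bsub>H\<^esub> x = e (\<zero>, \<ominus> b, \<ominus> c)"
    by (intro H.inv_equality) (auto simp: one_H l_neg)
  then show "inv\<^bsub>H\<^esub> x \<in> base_subgroup" using x by (auto simp: base_subgroup_def)
qed (auto simp: base_subgroup_def)

lemma base_subgroup_comm: "comm_group (H\<lparr>carrier := base_subgroup\<rparr>)"
proof -
  interpret B: group "H\<lparr>carrier := base_subgroup\<rparr>"
    using base_subgroup_subgroup by (rule H.subgroup_imp_group)
  show ?thesis
    by (rule B.group_comm_groupI) (auto simp: base_subgroup_def a_comm)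
qed

lemma card_base_subgroup: "card base_subgroup = card (carrier R) ^ 2"
proof -
  have "inj_on (\<lambda>(b, c). e (\<zero>, b, c)) (carrier R \<times> carrier R)"
    by (auto intro!: inj_onI)
  then show ?thesis
    unfolding base_subgroup_def by (simp only: card_image card_cartesian_product power2_eq_square)
qed

text \<open>Either \<open>A\<close> meets the base subgroup outside the centre, and then commuting
  confines \<open>A\<close> to the base subgroup; or second coordinates in \<open>A\<close> are a
  function \<open>T\<close> of the first, and commuting yields the identity excluded by
  \<open>not_split\<close>.\<close>

lemma abelian_subgroup_eq_base_subgroup:
  assumes fin: "finite (carrier R)"
    and not_split: "\<nexists>T. \<forall>a \<in> carrier R. \<forall>a' \<in> carrier R.
      T a \<in> carrier R \<and> a \<otimes> T a' \<oplus> g a a' = a' \<otimes> T a \<oplus> g a' a"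
    and A: "subgroup A H" "comm_group (H\<lparr>carrier := A\<rparr>)" "card A = card (carrier R) ^ 2"
  shows "A = base_subgroup"
proof -
  have sub: "A \<subseteq> carrier H" using A(1) by (rule subgroup.subset)
  have form: "commutator_form a b a' b' = \<zero>"
    if "a \<in> carrier R" "b \<in> carrier R" "c \<in> carrier R" "a' \<in> carrier R" "b' \<in> carrier R" "c' \<in> carrier R"
      "e (a, b, c) \<in> A" "e (a', b', c') \<in> A" for a b c a' b' c'
    using commute_iff[OF that(1-6)] comm_groupE(4)[OF A(2)] that(7,8) by simp
  show ?thesis
  proof (cases "\<exists>b \<in> carrier R. \<exists>c \<in> carrier R. b \<noteq> \<zero> \<and> e (\<zero>, b, c) \<in> A")
    case True
    then obtain b c where b: "b \<in> carrier R" "c \<in> carrier R" "b \<noteq> \<zero>" "e (\<zero>, b, c) \<in> A"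
      by blast
    \<comment> \<open>The form of \<open>(0, b)\<close> with \<open>(a', b')\<close> is
      \<open>- a' b\<close>, so commuting forces \<open>a' = 0\<close>, and equality follows by
      counting.\<close>
    have "A \<subseteq> base_subgroup"
    proof
      fix x assume x: "x \<in> A"
      then have "x \<in> carrier H" using sub by blast
      then obtain a' b' c' where x': "a' \<in> carrier R" "b' \<in> carrier R" "c' \<in> carrier R" "x = e (a', b', c')"
        by (rule H_cases)
      then have "commutator_form \<zero> b a' b' = \<zero>"
        using form b x by blast
      then have "a' \<otimes> b = \<zero>"
        using b x' by (simp add: commutator_form_def a_minus_def)
      then have "a' = \<zero>" using b x' by (simp add: integral_iff)
      then show "x \<in> base_subgroup" using x' by (auto simp: base_subgroup_def)
    qed
    moreover have "finite base_subgroup" using fin by (simp add: base_subgroup_def)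
    ultimately show ?thesis
      using A(3) card_base_subgroup by (intro card_subset_eq) auto
  next
    case False
    \<comment> \<open>The quotient of two elements with equal first coordinate has first coordinate
      zero, so in this case its second coordinate is zero as well.\<close>
    have b_eq: "b = b'"
      if "a \<in> carrier R" "b \<in> carrier R" "c \<in> carrier R" "b' \<in> carrier R" "c' \<in> carrier R"
        "e (a, b, c) \<in> A" "e (a, b', c') \<in> A" for a b c b' c'
    proof -
      let ?y = "inv\<^bsub>H\<^esub> (e (a, b', c'))"
      have "e (a, b, c) \<otimes>\<^bsub>H\<^esub> ?y \<in> A"
        using A(1) that by (meson subgroup.m_closed subgroup.m_inv_closed)
      moreover from this have "e (a, b, c) \<otimes>\<^bsub>H\<^esub> ?y \<in> carrier H" using sub by blast
      then obtain u v w where uvw: "u \<in> carrier R" "v \<in> carrier R" "w \<in> carrier R"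
          "e (a, b, c) \<otimes>\<^bsub>H\<^esub> ?y = e (u, v, w)"
        by (rule H_cases)
      then have "e (a, b, c) = e (u, v, w) \<otimes>\<^bsub>H\<^esub> e (a, b', c')"
        using that by (metis H.inv_solve_right' H.inv_closed mem_H)
      then have "u \<oplus> a = a" "b = v \<oplus> b'" using that uvw by auto
      then have "u = \<zero>" using that uvw by (simp add: add.l_cancel_one)
      ultimately have "v = \<zero>" using False uvw by auto
      then show ?thesis using \<open>b = v \<oplus> b'\<close> that by simp
    qed
    \<comment> \<open>The first and third coordinates determine an element of \<open>A\<close>, so all \<open>q ^ 2\<close> pairs occur.\<close>
    have "\<exists>b \<in> carrier R. \<exists>c \<in> carrier R. e (a, b, c) \<in> A" if a: "a \<in> carrier R" for a
    proof (rule ccontr)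
      assume no: "\<not> ?thesis"
      define \<pi> where "\<pi> x = (case inv_into (carrier R \<times> carrier R \<times> carrier R) e x of (a, b, c) \<Rightarrow> (a, c))" for x
      have \<pi>: "\<pi> (e (a, b, c)) = (a, c)" if "a \<in> carrier R" "b \<in> carrier R" "c \<in> carrier R" for a b c
        using that inv_into_f_f[OF inj] by (simp add: \<pi>_def)
      have "inj_on \<pi> A"
      proof (rule inj_onI)
        fix x y assume xy: "x \<in> A" "y \<in> A" and eq: "\<pi> x = \<pi> y"
        obtain a b c where x: "a \<in> carrier R" "b \<in> carrier R" "c \<in> carrier R" "x = e (a, b, c)"
          using H_cases[OF subsetD[OF sub xy(1)]] by blast
        obtain a' b' c' where y: "a' \<in> carrier R" "b' \<in> carrier R" "c' \<in> carrier R" "y = e (a', b', c')"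
          using H_cases[OF subsetD[OF sub xy(2)]] by blast
        have "a' = a" "c' = c" using eq x y by (auto simp: \<pi>)
        then show "x = y" using b_eq x y xy by metis
      qed
      moreover have "\<pi> ` A \<subseteq> (carrier R - {a}) \<times> carrier R"
      proof
        fix u assume "u \<in> \<pi> ` A"
        then obtain x where x: "x \<in> A" "u = \<pi> x" by blast
        then obtain a' b' c' where "a' \<in> carrier R" "b' \<in> carrier R" "c' \<in> carrier R" "x = e (a', b', c')"
          using H_cases[OF subsetD[OF sub x(1)]] by blast
        then show "u \<in> (carrier R - {a}) \<times> carrier R" using x no by (auto simp: \<pi>)
      qed
      ultimately have "card A \<le> card ((carrier R - {a}) \<times> carrier R)"
        using fin by (metis card_image card_mono finite_Diff finite_cartesian_product)
      also have "\<dots> < card (carrier R \<times> carrier R)"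
        using a fin by (intro psubset_card_mono) auto
      also have "\<dots> = card (carrier R) ^ 2"
        by (simp add: card_cartesian_product power2_eq_square)
      finally show False using A(3) by simp
    qed
    then obtain T where T: "\<And>a. a \<in> carrier R \<Longrightarrow> T a \<in> carrier R \<and> (\<exists>c \<in> carrier R. e (a, T a, c) \<in> A)"
      by metis
    have "a \<otimes> T a' \<oplus> g a a' = a' \<otimes> T a \<oplus> g a' a" if "a \<in> carrier R" "a' \<in> carrier R" for a a'
    proof -
      have "commutator_form a (T a) a' (T a') = \<zero>"
        using T[OF that(1)] T[OF that(2)] form that by blast
      then show ?thesis using that T by (simp add: commutator_form_def)
    qed
    then show ?thesis using not_split T by blast
  qed
qed

end

text \<open>No additivity of \<open>T\<close> is assumed: the value at one determines
  \<open>T\<close>, and the remaining identity is a trinomial in \<open>a\<close> of degree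
  \<open>p ^ 2\<close> that would vanish on more than \<open>p ^ 2\<close> elements.\<close>

lemma (in field) no_splitting:
  fixes p n :: nat
  assumes p: "Factorial_Ring.prime p" and n: "n \<ge> 3" and card: "card (carrier R) = p ^ n"
  shows "\<nexists>T. \<forall>a \<in> carrier R. \<forall>a' \<in> carrier R. T a \<in> carrier R \<and>
    a \<otimes> T a' \<oplus> a [^] p \<otimes> a' [^] (p ^ 2) = a' \<otimes> T a \<oplus> a' [^] p \<otimes> a [^] (p ^ 2)"
proof
  assume "\<exists>T. \<forall>a \<in> carrier R. \<forall>a' \<in> carrier R. T a \<in> carrier R \<and>
    a \<otimes> T a' \<oplus> a [^] p \<otimes> a' [^] (p ^ 2) = a' \<otimes> T a \<oplus> a' [^] p \<otimes> a [^] (p ^ 2)"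
  then obtain T where T: "\<And>a. a \<in> carrier R \<Longrightarrow> T a \<in> carrier R"
    and eq: "\<And>a a'. a \<in> carrier R \<Longrightarrow> a' \<in> carrier R \<Longrightarrow>
      a \<otimes> T a' \<oplus> a [^] p \<otimes> a' [^] (p ^ 2) = a' \<otimes> T a \<oplus> a' [^] p \<otimes> a [^] (p ^ 2)"
    by blast
  have p1: "1 < p" using p by (rule prime_gt_1_nat)
  then have pp: "p < p ^ 2" by (simp add: power2_eq_square)
  \<comment> \<open>Here \<open>n \<ge> 3\<close> enters.\<close>
  have large: "p ^ 2 < card (carrier R)"
    unfolding card using n p1 by (intro power_strict_increasing) auto
  \<comment> \<open>If every \<open>d\<close> satisfied \<open>d ^ p = d\<close>, iterating would
    give \<open>d ^ (p ^ 2) = d\<close> everywhere; this is a trinomial with middle coefficient zero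
    and too many roots.\<close>
  have "{d \<in> carrier R. d [^] p = d} \<noteq> carrier R"
  proof
    assume all: "{d \<in> carrier R. d [^] p = d} = carrier R"
    have "d [^] (p ^ 2) = d" if "d \<in> carrier R" for d
      using all that by (metis (mono_tags, lifting) mem_Collect_eq nat_pow_pow power2_eq_square)
    then have "{d \<in> carrier R. \<one> \<otimes> d [^] (p ^ 2) \<oplus> \<zero> \<otimes> d [^] p \<oplus> \<ominus> \<one> \<otimes> d = \<zero>} = carrier R"
      by (auto simp: l_minus r_neg)
    then show False
      using card_trinomial_roots_le[of \<one> \<zero> "\<ominus> \<one>" p "p ^ 2"] p1 pp large by simp
  qed
  then obtain d where d: "d \<in> carrier R" "d [^] p \<noteq> d" by blast
  define t where "t = T \<one>"
  have t: "t \<in> carrier R" using T by (simp add: t_def)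
  \<comment> \<open>The identity at \<open>a' = 1\<close>, solved for \<open>T a\<close>.\<close>
  have T_eq: "T a = a \<otimes> t \<oplus> a [^] p \<ominus> a [^] (p ^ 2)" if a: "a \<in> carrier R" for a
  proof -
    have "a \<otimes> t \<oplus> a [^] p = T a \<oplus> a [^] (p ^ 2)"
      using eq[of a \<one>] a T t by (simp add: t_def)
    then show ?thesis using a T t by (simp add: a_minus_def a_assoc r_neg)
  qed
  have "(d \<ominus> d [^] p) \<otimes> a [^] (p ^ 2) \<oplus> (d [^] (p ^ 2) \<ominus> d) \<otimes> a [^] p \<oplus> (d [^] p \<ominus> d [^] (p ^ 2)) \<otimes> a = \<zero>"
    if a: "a \<in> carrier R" for a
  proof -
    \<comment> \<open>Naming the powers makes the rearrangement a polynomial identity in independent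
      elements; substituting \<open>T_eq\<close> at \<open>a\<close> and \<open>d\<close>, the terms
      in \<open>t\<close> cancel.\<close>
    define a1 a2 d1 d2 where "a1 = a [^] p" and "a2 = a [^] (p ^ 2)"
      and "d1 = d [^] p" and "d2 = d [^] (p ^ 2)"
    have cl: "a1 \<in> carrier R" "a2 \<in> carrier R" "d1 \<in> carrier R" "d2 \<in> carrier R"
      using a d by (simp_all add: a1_def a2_def d1_def d2_def)
    have "a \<otimes> (d \<otimes> t \<oplus> d1 \<ominus> d2) \<oplus> a1 \<otimes> d2 = d \<otimes> (a \<otimes> t \<oplus> a1 \<ominus> a2) \<oplus> d1 \<otimes> a2"
      using eq[OF a d(1)] T_eq a d by (simp add: a1_def a2_def d1_def d2_def)
    moreover have "(d \<ominus> d1) \<otimes> a2 \<oplus> (d2 \<ominus> d) \<otimes> a1 \<oplus> (d1 \<ominus> d2) \<otimes> a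
      = (a \<otimes> (d \<otimes> t \<oplus> d1 \<ominus> d2) \<oplus> a1 \<otimes> d2) \<ominus> (d \<otimes> (a \<otimes> t \<oplus> a1 \<ominus> a2) \<oplus> d1 \<otimes> a2)"
      using a d t cl by algebra
    ultimately have "(d \<ominus> d1) \<otimes> a2 \<oplus> (d2 \<ominus> d) \<otimes> a1 \<oplus> (d1 \<ominus> d2) \<otimes> a = \<zero>"
      using a d t cl by simp
    then show ?thesis by (simp add: a1_def a2_def d1_def d2_def)
  qed
  then have "{a \<in> carrier R. (d \<ominus> d [^] p) \<otimes> a [^] (p ^ 2) \<oplus> (d [^] (p ^ 2) \<ominus> d) \<otimes> a [^] p
      \<oplus> (d [^] p \<ominus> d [^] (p ^ 2)) \<otimes> a = \<zero>} = carrier R"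
    by auto
  \<comment> \<open>The leading coefficient is nonzero by the choice of \<open>d\<close>.\<close>
  moreover have "d \<ominus> d [^] p \<noteq> \<zero>" using d by auto
  ultimately show False
    using card_trinomial_roots_le[of "d \<ominus> d [^] p" "d [^] (p ^ 2) \<ominus> d" "d [^] p \<ominus> d [^] (p ^ 2)" p "p ^ 2"]
      p1 pp large d by simp
qed

section \<open>The group over the field with \<open>p ^ n\<close> elements\<close>

theorem theorem1p2:
  fixes p n :: nat
  assumes "Factorial_Ring.prime p" and "n \<ge> 3"
  shows "\<exists>G :: nat monoid.
           ultraspecial p G \<and> order G = p ^ (3 * n) \<and>
           (\<exists>!A. subgroup A G \<and> comm_group (G\<lparr>carrier := A\<rparr>) \<and> card A = p ^ (2 * n))"
proof -
  have "n > 0" using assms(2) by simp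
  then obtain F :: "((int list \<times> nat) multiset \<Rightarrow> int) ring"
    where F: "field F" and card: "card (carrier F) = p ^ n" and char: "add_pow F p \<one>\<^bsub>F\<^esub> = \<zero>\<^bsub>F\<^esub>"
    using exists_field_of_prime_power_order[OF assms(1)] by blast
  interpret F: field F by (rule F)
  \<comment> \<open>Infinite sets have \<open>card\<close> zero, so a nonzero cardinality gives
    finiteness.\<close>
  have "p ^ n \<noteq> 0" using assms(1) by auto
  then have fin: "finite (carrier F)" using card by (metis card.infinite)
  then have "finite (carrier F \<times> carrier F \<times> carrier F)" by simp
  \<comment> \<open>The finite set of triples is coded by natural numbers to place the group on type
    \<open>nat\<close>.\<close>
  then obtain e :: "_ \<Rightarrow> nat" where e: "inj_on e (carrier F \<times> carrier F \<times> carrier F)"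
    using finite_imp_inj_to_nat_seg by blast
  \<comment> \<open>Two different Frobenius exponents keep \<open>g\<close> biadditive but give the
    trinomial of \<open>no_splitting\<close> its degree \<open>p ^ 2\<close>.\<close>
  define g where "g x y = x [^]\<^bsub>F\<^esub> p \<otimes>\<^bsub>F\<^esub> y [^]\<^bsub>F\<^esub> (p ^ 2)" for x y
  interpret G: twisted_heisenberg F e g
  proof
    fix x y z assume "x \<in> carrier F" "y \<in> carrier F" "z \<in> carrier F"
    then show "g (x \<oplus>\<^bsub>F\<^esub> y) z = g x z \<oplus>\<^bsub>F\<^esub> g y z" "g x (y \<oplus>\<^bsub>F\<^esub> z) = g x y \<oplus>\<^bsub>F\<^esub> g x z"
      using F.frobenius_add[OF assms(1) char] F.frobenius_pow_add[OF assms(1) char]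
      by (simp_all add: g_def F.l_distr F.r_distr)
  qed (use e in \<open>auto simp: g_def\<close>)
  have "A = G.base_subgroup"
    if "subgroup A G.H" "comm_group (G.H\<lparr>carrier := A\<rparr>)" "card A = p ^ (2 * n)" for A
  proof (rule G.abelian_subgroup_eq_base_subgroup[OF fin _ that(1,2)])
    show "\<nexists>T. \<forall>a \<in> carrier F. \<forall>a' \<in> carrier F. T a \<in> carrier F \<and>
      a \<otimes>\<^bsub>F\<^esub> T a' \<oplus>\<^bsub>F\<^esub> g a a' = a' \<otimes>\<^bsub>F\<^esub> T a \<oplus>\<^bsub>F\<^esub> g a' a"
      unfolding g_def using F.no_splitting[OF assms card] .
    show "card A = card (carrier F) ^ 2"
      using that(3) card by (simp add: power_mult[symmetric] mult.commute)
  qed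
  moreover have card_base: "card G.base_subgroup = p ^ (2 * n)"
    by (simp add: G.card_base_subgroup card power_mult[symmetric] mult.commute)
  ultimately have "\<exists>!A. subgroup A G.H \<and> comm_group (G.H\<lparr>carrier := A\<rparr>) \<and> card A = p ^ (2 * n)"
    using G.base_subgroup_subgroup G.base_subgroup_comm card_base by metis
  moreover have "order G.H = p ^ (3 * n)"
    using G.order_H card by (simp add: power_mult[symmetric] mult.commute)
  ultimately show ?thesis
    using G.ultraspecial_H[OF assms(1) card char] by blast
qed

end
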